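(* Let $(X_{\zeta},S,\mathbb{Z}^{d})$ be the substitutive subshift of an aperiodic primitive constant-shape substitution $\zeta$ on an alphabet $\mathcal A$ with expansion matrix $L_\zeta$ and support $F_1^\zeta$. Then the quotient group $\mathrm{Aut}(X_{\zeta},S,\mathbb{Z}^{d})/\langle S\rangle$ is finite. Moreover, a bound for $|\mathrm{Aut}(X_{\zeta},S,\mathbb{Z}^{d})/\langle S \rangle|$ is given by an explicit formula depending only on $d$, $|\mathcal A|$, $\Vert L_{\zeta}^{-1}\Vert$ and $\Vert F_{1}^{\zeta}\Vert$.
   Context: Fix $d\ge 1$; $\|\cdot\|$ is the Euclidean norm on $\mathbb{R}^d$ and the induced operator norm on matrices; for a finite set $A$, $\|A\|=\max_{a\in A}\|a\|$. An integer $d\times d$ matrix $L$ is an expansion matrix if there is $\lambda>1$ with $\|Lx\|>\lambda\|x\|$ for all $x\in\mathbb{R}^d\setminus\{0\}$. A fundamental domain of $L(\mathbb{Z}^d)$ in $\mathbb{Z}^d$ is a set containing exactly one representative of each class of $\mathbb{Z}^d/L(\mathbb{Z}^d)$; it is always taken to contain $0$. For a finite alphabet $\mathcal A$, $\mathcal A^{\mathbb{Z}^d}$ has the product topology and $\mathbb{Z}^d$ acts by $S^{n}(x)_{k}=x_{n+k}$. A subshift is a closed $S$-invariant subset. A pattern is an element of $\mathcal A^P$ with $P\subset\mathbb{Z}^d$ finite; it occurs in $x$ (or in a larger pattern) if it equals, up to translation of its support, a restriction of it. $\mathrm{Aut}(X,S,\mathbb{Z}^d)$ is the group of homeomorphisms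 of the subshift $X$ commuting with all $S^n$, and $\langle S\rangle=\{S^n: n\in\mathbb{Z}^d\}$. A constant-shape substitution with expansion matrix $L=L_\zeta$ and support $F_1=F_1^\zeta$ (a fundamental domain of $L(\mathbb{Z}^d)$ in $\mathbb{Z}^d$) is a map $\zeta:\mathcal A\to\mathcal A^{F_1}$. Put $F_{n+1}=L(F_n)+F_1$; the iterates $\zeta^n:\mathcal A\to\mathcal A^{F_n}$ are defined by $\zeta^1=\zeta$ and $\zeta^{n+1}(a)_{L(j)+f}=\zeta(\zeta^n(a)_j)_f$ for $j\in F_n$, $f\in F_1$. $X_\zeta\subseteq \mathcal A^{\mathbb{Z}^d}$ is the set of all $x$ such that every pattern occurring in $x$ occurs in $\zeta^n(a)$ for some $n>0$, $a\in\mathcal A$. $\zeta$ is primitive if there is $n>0$ such that for all $a,b\in\mathcal A$, $b$ occurs in $\zeta^n(a)$. $\zeta$ is aperiodic if $S^px=x$ with $x\in X_\zeta$, $p\in\mathbb{Z}^d$, implies $p=0$. Standing assumption: the sequence of supports $(F_n)_{n>0}$ is Følner, i.e. $|F_n\Delta(m+F_n)|/|F_n|\to0$ for every $m\in\mathbb{Z}^d$. *)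

theory Defs
  imports "HOL-Analysis.Analysis" "HOL-Algebra.Bij" "HOL-Algebra.Coset"
begin

section \<open>Expansion matrices and supports\<close>

abbreviation real_vec :: "int^'d \<Rightarrow> real^'d"
  where "real_vec v \<equiv> (\<chi> i. real_of_int (v $ i))"

abbreviation real_mat :: "int^'d^'d \<Rightarrow> real^'d^'d"
  where "real_mat L \<equiv> map_matrix real_of_int L"

definition expansion_matrix :: "int^'d^'d \<Rightarrow> bool"
  where "expansion_matrix L \<longleftrightarrow>
    (\<exists>c>1. \<forall>x::real^'d. x \<noteq> 0 \<longrightarrow> norm (real_mat L *v x) > c * norm x)"

definition fundamental_domain :: "int^'d^'d \<Rightarrow> (int^'d) set \<Rightarrow> bool"
  where "fundamental_domain L F \<longleftrightarrow>
    0 \<in> F \<and> (\<forall>k. \<exists>!f. f \<in> F \<and> k - f \<in> range (\<lambda>z. L *v z))"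

definition inv_opnorm :: "int^'d^'d \<Rightarrow> real"
  where "inv_opnorm L = onorm (\<lambda>x. matrix_inv (real_mat L) *v x)"

definition set_norm :: "(int^'d) set \<Rightarrow> real"
  where "set_norm A = Max ((\<lambda>a. norm (real_vec a)) ` A)"

text \<open>The recursion starts at \<open>F\<^sub>0 = {0}\<close>, which gives \<open>F\<^sub>1\<close> at index 1.\<close>

primrec support :: "int^'d^'d \<Rightarrow> (int^'d) set \<Rightarrow> nat \<Rightarrow> (int^'d) set"
  where
    "support L F1 0 = {0}"
  | "support L F1 (Suc n) = (\<Union>j\<in>support L F1 n. \<Union>f\<in>F1. {L *v j + f})"

definition folner :: "(nat \<Rightarrow> (int^'d) set) \<Rightarrow> bool"
  where "folner F \<longleftrightarrow>
    (\<forall>m. (\<lambda>n. real (card (sym_diff (F n) ((+) m ` F n))) / real (card (F n))) \<longlonglongrightarrow> 0)"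


section \<open>Constant-shape substitutions\<close>

text \<open>
  A pattern with support \<open>P\<close> is a total function of which only the values on \<open>P\<close> are used.
  In particular a substitution \<open>\<zeta>\<close> with support \<open>F\<^sub>1\<close> is a function
  \<open>'a \<Rightarrow> int^'d \<Rightarrow> 'a\<close>, and everything below depends only on
  \<open>\<zeta> a f\<close> for \<open>f \<in> F\<^sub>1\<close>.

  For a fundamental domain \<open>F\<^sub>1\<close> and injective \<open>L\<close>, each \<open>k\<close> is uniquely \<open>L j + f\<close> with
  \<open>f \<in> F\<^sub>1\<close>; \<open>lattice_quot\<close> returns this \<open>j\<close>. The iteration starts with \<open>\<zeta>\<^sup>0(a)\<close>, the letter
  \<open>a\<close> at the origin.
\<close>

definition lattice_quot :: "int^'d^'d \<Rightarrow> (int^'d) set \<Rightarrow> int^'d \<Rightarrow> int^'d"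
  where "lattice_quot L F1 k = (THE j. k - L *v j \<in> F1)"

primrec subst_iter ::
    "int^'d^'d \<Rightarrow> (int^'d) set \<Rightarrow> ('a \<Rightarrow> int^'d \<Rightarrow> 'a) \<Rightarrow> nat \<Rightarrow> 'a \<Rightarrow> int^'d \<Rightarrow> 'a"
  where
    "subst_iter L F1 \<zeta> 0 a = (\<lambda>k. a)"
  | "subst_iter L F1 \<zeta> (Suc n) a =
      (\<lambda>k. \<zeta> (subst_iter L F1 \<zeta> n a (lattice_quot L F1 k)) (k - L *v lattice_quot L F1 k))"

text \<open>The pattern \<open>p\<close> with support \<open>P\<close> occurs in \<open>q\<close> with support \<open>Q\<close>; points of the full shift
  are the case \<open>Q = UNIV\<close>.\<close>

definition occurs_in ::
    "(int^'d) set \<Rightarrow> (int^'d \<Rightarrow> 'a) \<Rightarrow> (int^'d) set \<Rightarrow> (int^'d \<Rightarrow> 'a) \<Rightarrow> bool"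
  where "occurs_in P p Q q \<longleftrightarrow> (\<exists>n. \<forall>k\<in>P. n + k \<in> Q \<and> q (n + k) = p k)"

definition subst_shift ::
    "int^'d^'d \<Rightarrow> (int^'d) set \<Rightarrow> ('a \<Rightarrow> int^'d \<Rightarrow> 'a) \<Rightarrow> (int^'d \<Rightarrow> 'a) set"
  where "subst_shift L F1 \<zeta> =
    {x. \<forall>P p. finite P \<and> occurs_in P p UNIV x \<longrightarrow>
          (\<exists>n>0. \<exists>a. occurs_in P p (support L F1 n) (subst_iter L F1 \<zeta> n a))}"

definition primitive_subst ::
    "int^'d^'d \<Rightarrow> (int^'d) set \<Rightarrow> ('a \<Rightarrow> int^'d \<Rightarrow> 'a) \<Rightarrow> bool"
  where "primitive_subst L F1 \<zeta> \<longleftrightarrow>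
    (\<exists>n>0. \<forall>a b. b \<in> subst_iter L F1 \<zeta> n a ` support L F1 n)"

definition shift :: "int^'d \<Rightarrow> (int^'d \<Rightarrow> 'a) \<Rightarrow> int^'d \<Rightarrow> 'a"
  where "shift n x = (\<lambda>k. x (n + k))"

definition aperiodic_subst ::
    "int^'d^'d \<Rightarrow> (int^'d) set \<Rightarrow> ('a \<Rightarrow> int^'d \<Rightarrow> 'a) \<Rightarrow> bool"
  where "aperiodic_subst L F1 \<zeta> \<longleftrightarrow>
    (\<forall>x\<in>subst_shift L F1 \<zeta>. \<forall>p. shift p x = x \<longrightarrow> p = 0)"

lemma expansion_matrix_inj:
  fixes L :: "int^'d^'d"
  assumes "expansion_matrix L"
  shows "inj (\<lambda>z. L *v z)"
proof (rule injI)
  fix y z :: "int^'d" assume eq: "L *v y = L *v z"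
  have lin: "real_mat L *v real_vec v = real_vec (L *v v)" for v :: "int^'d"
    by (simp add: vec_eq_iff matrix_vector_mult_def)
  define w where "w = real_vec y - real_vec z"
  have Lw: "real_mat L *v w = 0"
    using eq by (simp add: w_def matrix_vector_mult_diff_distrib lin)
  obtain c where c: "c > 1" "\<forall>x::real^'d. x \<noteq> 0 \<longrightarrow> norm (real_mat L *v x) > c * norm x"
    using assms unfolding expansion_matrix_def by (elim exE conjE)
  have "w = 0"
  proof (rule ccontr)
    assume "w \<noteq> 0"
    then have "c * norm w < norm (real_mat L *v w)"
      using c(2) by (elim allE impE)
    then show False
      unfolding Lw norm_zero using c(1) by (simp add: mult_less_0_iff)
  qed
  then show "y = z"
    by (simp add: w_def vec_eq_iff)
qed

lemma lattice_quot_eq: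
  assumes "expansion_matrix L" "fundamental_domain L F1" "f \<in> F1"
  shows "lattice_quot L F1 (L *v j + f) = j"
  unfolding lattice_quot_def
proof (rule the_equality)
  show "L *v j + f - L *v j \<in> F1"
    using assms(3) by simp
next
  fix i assume i: "L *v j + f - L *v i \<in> F1"
  have uniq: "\<exists>!g. g \<in> F1 \<and> L *v j + f - g \<in> range (\<lambda>z. L *v z)"
    using assms(2) unfolding fundamental_domain_def by (elim conjE allE)
  have "f \<in> F1 \<and> L *v j + f - f \<in> range (\<lambda>z. L *v z)"
    using assms(3) by simp
  moreover have "L *v j + f - L *v i \<in> F1 \<and>
      L *v j + f - (L *v j + f - L *v i) \<in> range (\<lambda>z. L *v z)"
    using i by simp
  ultimately have "L *v j + f - L *v i = f"
    using uniq by (metis (no_types, lifting))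
  then have "L *v i = L *v j"
    by (simp add: algebra_simps)
  then show "i = j"
    using injD[OF expansion_matrix_inj[OF assms(1)]] by blast
qed

lemma support_1: "support L F1 (Suc 0) = F1"
  by (simp add: matrix_vector_mult_def flip: zero_vec_def)

lemma subst_iter_1:
  assumes "expansion_matrix L" "fundamental_domain L F1" "f \<in> F1"
  shows "subst_iter L F1 \<zeta> (Suc 0) a f = \<zeta> a f"
  using lattice_quot_eq[OF assms, of 0] by simp

lemma subst_iter_Suc:
  assumes "expansion_matrix L" "fundamental_domain L F1" "f \<in> F1"
  shows "subst_iter L F1 \<zeta> (Suc n) a (L *v j + f) = \<zeta> (subst_iter L F1 \<zeta> n a j) f"
  using lattice_quot_eq[OF assms, of j] by simp


section \<open>The automorphism group\<close>

definition subshift_topology :: "(int^'d \<Rightarrow> 'a) set \<Rightarrow> (int^'d \<Rightarrow> 'a) topology"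
  where "subshift_topology X =
    subtopology (product_topology (\<lambda>_. discrete_topology UNIV) UNIV) X"

text \<open>As in \<^const>\<open>BijGroup\<close>, maps are extensional, so that equality of group elements is equality
  of maps on \<open>X\<close>.\<close>

definition automorphisms :: "(int^'d \<Rightarrow> 'a) set \<Rightarrow> ((int^'d \<Rightarrow> 'a) \<Rightarrow> (int^'d \<Rightarrow> 'a)) set"
  where "automorphisms X =
    {\<phi> \<in> extensional X. homeomorphic_map (subshift_topology X) (subshift_topology X) \<phi> \<and>
        (\<forall>n. \<forall>x\<in>X. \<phi> (shift n x) = shift n (\<phi> x))}"

definition Aut :: "(int^'d \<Rightarrow> 'a) set \<Rightarrow> ((int^'d \<Rightarrow> 'a) \<Rightarrow> (int^'d \<Rightarrow> 'a)) monoid"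
  where "Aut X = BijGroup X \<lparr>carrier := automorphisms X\<rparr>"

definition shifts :: "(int^'d \<Rightarrow> 'a) set \<Rightarrow> ((int^'d \<Rightarrow> 'a) \<Rightarrow> (int^'d \<Rightarrow> 'a)) set"
  where "shifts X = range (\<lambda>n. restrict (shift n) X)"

lemma topspace_subshift_topology [simp]: "topspace (subshift_topology X) = X"
  by (simp add: subshift_topology_def)

lemma automorphisms_Bij: "automorphisms X \<subseteq> Bij X"
  unfolding automorphisms_def Bij_def bij_betw_def
  using homeomorphic_imp_surjective_map homeomorphic_imp_injective_map by fastforce

lemma group_Aut:
  assumes inv: "\<And>n x. x \<in> X \<Longrightarrow> shift n x \<in> X"
  shows "group (Aut X)"
proof -
  interpret B: group "BijGroup X" by (rule group_BijGroup)
  have car: "carrier (BijGroup X) = Bij X" by (simp add: BijGroup_def)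
  have "subgroup (automorphisms X) (BijGroup X)"
  proof (rule B.subgroupI)
    show "automorphisms X \<subseteq> carrier (BijGroup X)"
      using automorphisms_Bij car by blast
    have "restrict id X \<in> automorphisms X"
      unfolding automorphisms_def
      by (auto simp: inv intro: homeomorphic_map_eq[where f=id])
    then show "automorphisms X \<noteq> {}" by blast
  next
    fix f assume f: "f \<in> automorphisms X"
    then have fB: "f \<in> Bij X" using automorphisms_Bij by blast
    then have bij: "bij_betw f X X" by (simp add: Bij_def)
    let ?g = "restrict (inv_into X f) X"
    obtain g where g: "homeomorphic_maps (subshift_topology X) (subshift_topology X) f g"
      using f by (auto simp: automorphisms_def homeomorphic_map_maps)
    have gX: "g y \<in> X \<and> f (g y) = y" if "y \<in> X" for y
      using g that by (auto simp: homeomorphic_maps_def continuous_map_def)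
    have g_eq: "g y = ?g y" if "y \<in> X" for y
      using gX[OF that] bij that by (metis bij_betw_inv_into_left restrict_apply)
    have "homeomorphic_map (subshift_topology X) (subshift_topology X) ?g"
      by (rule homeomorphic_map_eq[where f=g])
        (use g g_eq in \<open>simp_all add: homeomorphic_maps_map\<close>)
    moreover have "?g (shift n y) = shift n (?g y)" if y: "y \<in> X" for n y
    proof -
      have "f (shift n (g y)) = shift n y"
        using f gX[OF y] by (simp add: automorphisms_def)
      then have "inv_into X f (shift n y) = shift n (g y)"
        using bij gX[OF y] inv by (metis bij_betw_inv_into_left)
      then show ?thesis using g_eq[OF y] inv y by simp
    qed
    ultimately have "?g \<in> automorphisms X" by (simp add: automorphisms_def)
    then show "inv\<^bsub>BijGroup X\<^esub> f \<in> automorphisms X"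
      using fB by (simp add: inv_BijGroup)
  next
    fix f g assume fg: "f \<in> automorphisms X" "g \<in> automorphisms X"
    then have B: "f \<in> Bij X" "g \<in> Bij X" using automorphisms_Bij by blast+
    have gX: "g x \<in> X" if "x \<in> X" for x
      using B(2) that Bij_imp_funcset by blast
    have "homeomorphic_map (subshift_topology X) (subshift_topology X) (compose X f g)"
    proof (rule homeomorphic_map_eq[where f="f \<circ> g"])
      show "homeomorphic_map (subshift_topology X) (subshift_topology X) (f \<circ> g)"
        using fg by (intro homeomorphic_map_compose) (auto simp: automorphisms_def)
    qed (simp add: compose_def)
    then have "compose X f g \<in> automorphisms X"
      using fg gX inv by (auto simp: automorphisms_def compose_def)
    then show "f \<otimes>\<^bsub>BijGroup X\<^esub> g \<in> automorphisms X"
      using B by (simp add: BijGroup_def)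
  qed
  then show ?thesis unfolding Aut_def by (rule B.subgroup_imp_group)
qed

lemma shift_in_subst_shift:
  assumes "x \<in> subst_shift L F1 \<zeta>"
  shows "shift n x \<in> subst_shift L F1 \<zeta>"
proof -
  have "occurs_in P p UNIV x" if "occurs_in P p UNIV (shift n x)" for P p
    using that unfolding occurs_in_def shift_def by (metis add.assoc UNIV_I)
  then show ?thesis using assms unfolding subst_shift_def by blast
qed

lemma normal_shifts:
  fixes X :: "(int^'d \<Rightarrow> 'a) set"
  assumes inv: "\<And>n x. x \<in> X \<Longrightarrow> shift n x \<in> X"
  shows "shifts X \<lhd> Aut X"
proof -
  interpret A: group "Aut X" using inv by (rule group_Aut)
  have mult: "f \<otimes>\<^bsub>Aut X\<^esub> g = compose X f g" if "f \<in> automorphisms X" "g \<in> automorphisms X" for f g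
    using that automorphisms_Bij by (auto simp: Aut_def BijGroup_def)
  have car: "carrier (Aut X) = automorphisms X" by (simp add: Aut_def)
  have one: "\<one>\<^bsub>Aut X\<^esub> = (\<lambda>x\<in>X. x)" by (simp add: Aut_def BijGroup_def)
  have cont: "continuous_map (subshift_topology X) (subshift_topology X) (shift n)" for n
    unfolding subshift_topology_def shift_def
    using inv by (intro continuous_map_into_subtopology continuous_map_from_subtopology)
      (auto simp: continuous_map_componentwise_UNIV shift_def Pi_iff
        intro: continuous_map_product_projection)
  have sh: "restrict (shift n) X \<in> automorphisms X" for n
  proof -
    have "homeomorphic_maps (subshift_topology X) (subshift_topology X) (shift n) (shift (- n))"
      using cont by (auto simp: homeomorphic_maps_def shift_def)
    then have "homeomorphic_map (subshift_topology X) (subshift_topology X) (shift n)"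
      by (rule homeomorphic_maps_imp_map)
    then have "homeomorphic_map (subshift_topology X) (subshift_topology X) (restrict (shift n) X)"
      by (rule homeomorphic_map_eq) simp
    then show ?thesis
      using inv by (auto simp: automorphisms_def shift_def add_ac)
  qed
  have shift_shift: "shift m (shift n x) = shift (m + n) x" for m n and x :: "int^'d \<Rightarrow> 'a"
    by (simp add: shift_def add_ac)
  have comp: "compose X (restrict (shift m) X) (restrict (shift n) X) = restrict (shift (m + n)) X" for m n
    using inv by (intro ext) (simp add: compose_def shift_shift)
  have zero: "restrict (shift 0) X = (\<lambda>x\<in>X. x)"
    by (auto simp: shift_def fun_eq_iff)
  have "subgroup (shifts X) (Aut X)"
  proof (rule A.subgroupI)
    fix f assume "f \<in> shifts X"
    then obtain n where n: "f = restrict (shift n) X" by (auto simp: shifts_def)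
    have "inv\<^bsub>Aut X\<^esub> f = restrict (shift (- n)) X"
      using sh by (intro A.inv_equality) (auto simp: n mult comp zero one car)
    then show "inv\<^bsub>Aut X\<^esub> f \<in> shifts X" by (auto simp: shifts_def)
  next
    fix f g assume "f \<in> shifts X" "g \<in> shifts X"
    then show "f \<otimes>\<^bsub>Aut X\<^esub> g \<in> shifts X"
      using sh by (auto simp: shifts_def mult comp)
  qed (use sh car in \<open>auto simp: shifts_def\<close>)
  moreover have "h \<otimes>\<^bsub>Aut X\<^esub> f = f \<otimes>\<^bsub>Aut X\<^esub> h" if h: "h \<in> automorphisms X" and f: "f \<in> shifts X" for h f
  proof -
    obtain n where n: "f = restrict (shift n) X" using f by (auto simp: shifts_def)
    have "h x \<in> X" if "x \<in> X" for x
      using h that automorphisms_Bij Bij_imp_funcset by blast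
    then have "compose X h f = compose X f h"
      using h inv by (auto simp: n compose_def automorphisms_def fun_eq_iff)
    then show ?thesis using h sh by (simp add: mult n)
  qed
  ultimately show ?thesis
    unfolding normal_def normal_axioms_def r_coset_def l_coset_def
    using A.is_group car by fastforce
qed


section \<open>The bound\<close>

text \<open>
  The bound counts the local rules over an alphabet of \<open>c\<close> letters whose window is the box
  \<open>{-R..R}\<^sup>d\<close>, where \<open>R\<close> is a nonnegative integer exceeding
  \<open>r = 3 \<parallel>L\<^sup>-\<^sup>1\<parallel> \<parallel>F\<^sub>1\<parallel> / (1 - \<parallel>L\<^sup>-\<^sup>1\<parallel>)\<close>.
  Here \<open>r\<close> is the attracting fixed point (\<open>\<parallel>L\<^sup>-\<^sup>1\<parallel> < 1\<close>) of
  \<open>t \<mapsto> \<parallel>L\<^sup>-\<^sup>1\<parallel> (t + 3 \<parallel>F\<^sub>1\<parallel>)\<close>: if \<open>\<zeta>\<close> is injective on letters,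
  \<open>\<phi> \<circ> \<zeta> = S\<^sup>p \<circ> \<zeta> \<circ> \<psi>\<close> with \<open>p \<in> F\<^sub>1\<close>, and \<open>\<phi>\<close> has a local rule of radius \<open>t\<close>, then
  \<open>\<psi>\<close> has one of radius \<open>\<parallel>L\<^sup>-\<^sup>1\<parallel> (t + 3 \<parallel>F\<^sub>1\<parallel>)\<close>; identifying letters with equal images
  reduces to the injective case without enlarging the alphabet.
\<close>

definition aut_bound :: "nat \<Rightarrow> nat \<Rightarrow> real \<Rightarrow> real \<Rightarrow> nat"
  where "aut_bound d c l f =
    (let R = nat \<lceil>3 * l * f / (1 - l)\<rceil> + 1 in c ^ (c ^ ((2 * R + 1) ^ d)))"

end

theory Submission
  imports Defs
begin

text \<open>
  The argument avoids recognizability. Given finitely many automorphisms \<open>\<phi>\<close>, take \<open>n\<close> large, a point \<open>x\<close>,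
  and desubstitute the images of the single point \<open>\<zeta>\<^sup>n(x)\<close>: \<open>\<phi>(\<zeta>\<^sup>n(x)) = S\<^sup>q \<zeta>\<^sup>n(z)\<close> with \<open>q \<in> F\<^sub>n\<close>,
  where \<open>z\<close> need not be unique. The local rule of \<open>\<phi>\<close>, pulled back along \<open>L\<^sup>n\<close>, expresses the image
  \<open>\<zeta>\<^sup>n(z\<^sub>m)\<close> through the images \<open>\<zeta>\<^sup>n(x\<^sub>k)\<close> with \<open>k\<close> in a box around \<open>m\<close> of a size independent of \<open>\<phi>\<close>. Two
  automorphisms with the same such rule have the same \<open>\<zeta>\<^sup>n(z)\<close>, so up to a shift they agree at
  \<open>\<zeta>\<^sup>n(x)\<close>, hence everywhere by minimality. The rules are counted by the bound.
\<close>

section \<open>Compactness of the full shift\<close>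

text \<open>With discrete factors the cylinders over finite windows form a basis, so openness and
  continuity reduce to agreement on finite windows.\<close>

lemma openin_cylinders:
  fixes U :: "('i \<Rightarrow> 'a) set"
  shows "openin (product_topology (\<lambda>_. discrete_topology UNIV) UNIV) U \<longleftrightarrow>
    (\<forall>x\<in>U. \<exists>W. finite W \<and> (\<forall>z. (\<forall>i\<in>W. z i = x i) \<longrightarrow> z \<in> U))"
proof (intro iffI ballI)
  fix x assume "openin (product_topology (\<lambda>_. discrete_topology UNIV) UNIV) U" "x \<in> U"
  then obtain V where V: "finite {i. V i \<noteq> UNIV}" "x \<in> PiE UNIV V" "PiE UNIV V \<subseteq> U"
    unfolding openin_product_topology_alt by force
  have "z \<in> U" if "\<forall>i\<in>{i. V i \<noteq> UNIV}. z i = x i" for z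
  proof -
    have "z i \<in> V i" for i
      using that V(2) by (cases "V i = UNIV") auto
    then show ?thesis using V(3) by auto
  qed
  then show "\<exists>W. finite W \<and> (\<forall>z. (\<forall>i\<in>W. z i = x i) \<longrightarrow> z \<in> U)"
    using V(1) by blast
next
  assume cyl: "\<forall>x\<in>U. \<exists>W. finite W \<and> (\<forall>z. (\<forall>i\<in>W. z i = x i) \<longrightarrow> z \<in> U)"
  have "\<exists>V. finite {i. V i \<noteq> UNIV} \<and> x \<in> PiE UNIV V \<and> PiE UNIV V \<subseteq> U" if "x \<in> U" for x
  proof -
    obtain W where W: "finite W" "\<And>z. (\<forall>i\<in>W. z i = x i) \<Longrightarrow> z \<in> U"
      using cyl \<open>x \<in> U\<close> by blast
    define V where "V = (\<lambda>i. if i \<in> W then {x i} else UNIV)"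
    have "{i. V i \<noteq> UNIV} \<subseteq> W" by (auto simp: V_def)
    moreover have "x \<in> PiE UNIV V" by (auto simp: V_def)
    moreover have "PiE UNIV V \<subseteq> U"
    proof
      fix z assume z: "z \<in> PiE UNIV V"
      have "z i = x i" if "i \<in> W" for i
        using PiE_mem[OF z, of i] that by (simp add: V_def)
      then have "\<forall>i\<in>W. z i = x i" by blast
      then show "z \<in> U" by (rule W(2))
    qed
    ultimately show ?thesis using W(1) finite_subset by blast
  qed
  then show "openin (product_topology (\<lambda>_. discrete_topology UNIV) UNIV) U"
    unfolding openin_product_topology_alt by simp
qed

text \<open>For finite \<open>W\<close>, \<open>local\<close> makes \<open>{z. P W z}\<close>
  clopen, and \<open>antimono\<close> turns a solution for a union of windows into one for each of
  them; compactness of the full shift gives a common solution. Points are built from finite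
  approximations this way.\<close>

lemma local_compactness:
  fixes P :: "'i set \<Rightarrow> ('i \<Rightarrow> 'a::finite) \<Rightarrow> bool"
  assumes ex: "\<And>W. finite W \<Longrightarrow> \<exists>z. P W z"
    and antimono: "\<And>V W z. V \<subseteq> W \<Longrightarrow> P W z \<Longrightarrow> P V z"
    and local: "\<And>W z z'. (\<forall>i\<in>W. z i = z' i) \<Longrightarrow> P W z \<Longrightarrow> P W z'"
  shows "\<exists>z. \<forall>W. finite W \<longrightarrow> P W z"
proof -
  let ?X = "product_topology (\<lambda>_::'i. discrete_topology (UNIV::'a set)) UNIV"
  define \<U> where "\<U> = (\<lambda>W. {z. P W z}) ` {W. finite W}"
  have "compact_space ?X"
    by (simp add: compact_space_product_topology compact_space_discrete_topology)
  moreover have "closedin ?X C" if C: "C \<in> \<U>" for C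
  proof -
    obtain W where W: "finite W" "C = {z. P W z}" using C by (auto simp: \<U>_def)
    have "openin ?X (- C)"
      unfolding openin_cylinders
    proof (intro ballI exI[of _ W] conjI allI impI)
      fix x z assume x: "x \<in> - C" and z: "\<forall>i\<in>W. z i = x i"
      then show "z \<in> - C" using local[of W z x] W by auto
    qed (rule W(1))
    then show ?thesis by (simp add: closedin_def Compl_eq_Diff_UNIV PiE_UNIV_domain)
  qed
  moreover have "\<Inter>\<F> \<noteq> {}" if \<F>: "finite \<F>" "\<F> \<subseteq> \<U>" for \<F>
  proof -
    obtain \<W> where \<W>: "\<W> \<subseteq> {W. finite W}" "finite \<W>" "\<F> = (\<lambda>W. {z. P W z}) ` \<W>"
      using finite_subset_image[OF \<F>[unfolded \<U>_def]] by blast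
    then have "finite (\<Union>\<W>)" by blast
    then obtain z where "P (\<Union>\<W>) z" using ex by blast
    then have "P W z" if "W \<in> \<W>" for W using antimono[OF Union_upper[OF that]] by blast
    then have "z \<in> \<Inter>\<F>" using \<W>(3) by blast
    then show ?thesis by blast
  qed
  ultimately have "\<Inter>\<U> \<noteq> {}" unfolding compact_space_fip by blast
  then show ?thesis by (auto simp: \<U>_def)
qed

text \<open>If every \<open>q\<close> failed on some window, the union of these finitely many
  windows would defeat all of \<open>Q\<close> at once.\<close>

lemma finite_pigeonhole_windows:
  assumes "finite Q" and ex: "\<And>W. finite W \<Longrightarrow> \<exists>q\<in>Q. P q W"
    and antimono: "\<And>q V W. V \<subseteq> W \<Longrightarrow> P q W \<Longrightarrow> P q V"
  shows "\<exists>q\<in>Q. \<forall>W. finite W \<longrightarrow> P q W"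
proof (rule ccontr)
  assume "\<not> ?thesis"
  then have "\<forall>q\<in>Q. \<exists>W. finite W \<and> \<not> P q W" by blast
  then obtain W where W: "\<forall>q\<in>Q. finite (W q) \<and> \<not> P q (W q)" by (rule bchoice[THEN exE])
  then have "finite (\<Union>q\<in>Q. W q)" using assms(1) by blast
  then obtain q where "q \<in> Q" "P q (\<Union>q\<in>Q. W q)" using ex by blast
  moreover from this(1) have "W q \<subseteq> (\<Union>q\<in>Q. W q)" by blast
  ultimately show False using W antimono by blast
qed

section \<open>Closedness of the subshift and finite windows of automorphisms\<close>

lemma shift_shift: "shift m (shift n x) = shift (m + n) x"
  by (simp add: shift_def add_ac)

text \<open>Membership constrains finite patterns only, so it passes to limits.\<close>

lemma subst_shift_closed:
  assumes "\<And>W. finite W \<Longrightarrow> \<exists>x\<in>subst_shift L F1 \<zeta>. \<forall>k\<in>W. x k = z k"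
  shows "z \<in> subst_shift L F1 \<zeta>"
  unfolding subst_shift_def
proof (intro CollectI allI impI)
  fix P p assume "finite P \<and> occurs_in P p UNIV z"
  then obtain n where P: "finite P" and n: "\<forall>k\<in>P. z (n + k) = p k"
    by (auto simp: occurs_in_def)
  obtain x where x: "x \<in> subst_shift L F1 \<zeta>" "\<forall>k\<in>(+) n ` P. x k = z k"
    using assms P by blast
  then have "occurs_in P p UNIV x" using n unfolding occurs_in_def by auto
  then show "\<exists>n>0. \<exists>a. occurs_in P p (support L F1 n) (subst_iter L F1 \<zeta> n a)"
    using x(1) P unfolding subst_shift_def mem_Collect_eq by blast
qed

text \<open>Without a deciding window, compactness gives a point \<open>z\<close> approximated by
  pairs with different images at 0, against continuity at \<open>z\<close>. As \<open>\<phi>\<close>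
  commutes with shifts, coordinate 0 stands for all others.\<close>

lemma curtis_hedlund_lyndon_window:
  fixes \<zeta> :: "'a::finite \<Rightarrow> int^'d \<Rightarrow> 'a"
  assumes \<phi>: "\<phi> \<in> automorphisms (subst_shift L F1 \<zeta>)"
  shows "\<exists>V. finite V \<and> (\<forall>x\<in>subst_shift L F1 \<zeta>. \<forall>x'\<in>subst_shift L F1 \<zeta>.
    (\<forall>k\<in>V. x k = x' k) \<longrightarrow> \<phi> x 0 = \<phi> x' 0)"
proof (rule ccontr)
  let ?X = "subst_shift L F1 \<zeta>"
  let ?P = "product_topology (\<lambda>_::int^'d. discrete_topology (UNIV::'a set)) UNIV"
  assume "\<not> ?thesis"
  then have bad: "\<exists>x\<in>?X. \<exists>x'\<in>?X. (\<forall>k\<in>V. x k = x' k) \<and> \<phi> x 0 \<noteq> \<phi> x' 0" if "finite V" for V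
    using that by blast
  \<comment> \<open>The bad pair is bound inside \<open>D\<close>, so that \<open>D V z\<close>
    depends only on \<open>z\<close> restricted to \<open>V\<close>.\<close>
  define D where "D = (\<lambda>V z. \<exists>x\<in>?X. \<exists>x'\<in>?X. (\<forall>k\<in>V. x k = z k) \<and> (\<forall>k\<in>V. x' k = z k) \<and> \<phi> x 0 \<noteq> \<phi> x' 0)"
  have "\<exists>z. \<forall>W. finite W \<longrightarrow> D W z"
  proof (rule local_compactness)
    fix W :: "(int^'d) set" assume "finite W"
    then obtain x x' where "x \<in> ?X" "x' \<in> ?X" "\<forall>k\<in>W. x k = x' k" "\<phi> x 0 \<noteq> \<phi> x' 0"
      using bad by blast
    then show "\<exists>z. D W z" unfolding D_def by force
  next
    show "D V z" if "V \<subseteq> W" "D W z" for V W z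
      using that unfolding D_def by blast
  next
    show "D W z'" if "\<forall>k\<in>W. z k = z' k" "D W z" for W z z'
      using that unfolding D_def by simp
  qed
  then obtain z where z: "\<And>W. finite W \<Longrightarrow> D W z" by blast
  have zX: "z \<in> ?X"
    by (rule subst_shift_closed) (use z D_def in blast)
  have "continuous_map (subshift_topology ?X) (subshift_topology ?X) \<phi>"
    using \<phi> by (auto simp: automorphisms_def homeomorphic_imp_continuous_map)
  then have "continuous_map (subshift_topology ?X) ?P \<phi>"
    unfolding subshift_topology_def continuous_map_in_subtopology by blast
  then have "continuous_map (subshift_topology ?X) (discrete_topology UNIV) (\<lambda>x. \<phi> x 0)"
    by (simp add: continuous_map_componentwise_UNIV)
  then have "openin (subshift_topology ?X) {x \<in> ?X. \<phi> x 0 = \<phi> z 0}"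
    using openin_continuous_map_preimage[of _ "discrete_topology UNIV" _ "{\<phi> z 0}"] by fastforce
  then obtain U where U: "openin ?P U" "{x \<in> ?X. \<phi> x 0 = \<phi> z 0} = U \<inter> ?X"
    unfolding subshift_topology_def openin_subtopology by blast
  have "z \<in> U" using U(2) zX by blast
  then obtain W where W: "finite W" "\<And>x. (\<forall>i\<in>W. x i = z i) \<Longrightarrow> x \<in> U"
    using U(1) unfolding openin_cylinders by blast
  obtain x x' where x: "x \<in> ?X" "x' \<in> ?X" "\<forall>k\<in>W. x k = z k" "\<forall>k\<in>W. x' k = z k" "\<phi> x 0 \<noteq> \<phi> x' 0"
    using z[OF W(1)] unfolding D_def by blast
  then have "x \<in> U \<inter> ?X" "x' \<in> U \<inter> ?X" using W(2) by blast+
  then have "\<phi> x 0 = \<phi> z 0" "\<phi> x' 0 = \<phi> z 0" unfolding U(2)[symmetric] by auto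
  then show False using x(5) by simp
qed

section \<open>Integer vectors and boxes\<close>

lemma real_vec_simps:
  shows "real_vec (u + v) = real_vec u + real_vec v"
    and "real_vec (u - v) = real_vec u - real_vec v"
    and "real_vec (A *v u) = real_mat A *v real_vec u"
  by (auto simp: vec_eq_iff matrix_vector_mult_def)

lemma card_int_box:
  "finite {v::int^'d. \<forall>i. \<bar>v $ i\<bar> \<le> int R}"
  "card {v::int^'d. \<forall>i. \<bar>v $ i\<bar> \<le> int R} = (2 * R + 1) ^ CARD('d)"
proof -
  let ?B = "{v::int^'d. \<forall>i. \<bar>v $ i\<bar> \<le> int R}"
  have "bij_betw vec_nth ?B (PiE (UNIV::'d set) (\<lambda>_. {- int R..int R}))"
  proof (rule bij_betw_byWitness[where f' = vec_lambda])
    show "vec_nth ` ?B \<subseteq> PiE UNIV (\<lambda>_. {- int R..int R})"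
      by (auto simp: abs_le_iff) (metis minus_le_iff)
    show "vec_lambda ` PiE UNIV (\<lambda>_. {- int R..int R}) \<subseteq> ?B"
      by (auto simp: PiE_iff abs_le_iff) (metis minus_le_iff)
  qed auto
  moreover have "finite (PiE (UNIV::'d set) (\<lambda>_. {- int R..int R}))"
    by (intro finite_PiE) auto
  moreover have "card (PiE (UNIV::'d set) (\<lambda>_. {- int R..int R})) = (2 * R + 1) ^ CARD('d)"
    by (simp add: card_PiE nat_add_distrib nat_mult_distrib)
  ultimately show "finite ?B" "card ?B = (2 * R + 1) ^ CARD('d)"
    by (simp_all add: bij_betw_finite bij_betw_same_card)
qed

section \<open>The substitution on configurations\<close>

locale constant_shape =
  fixes L :: "int^'d^'d" and F1 :: "(int^'d) set" and \<zeta> :: "'a::finite \<Rightarrow> int^'d \<Rightarrow> 'a"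
  assumes expansion: "expansion_matrix L"
    and domain: "fundamental_domain L F1"
begin

abbreviation Q :: "int^'d \<Rightarrow> int^'d" where "Q \<equiv> lattice_quot L F1"
abbreviation X where "X \<equiv> subst_shift L F1 \<zeta>"
abbreviation F where "F \<equiv> support L F1"
abbreviation E where "E n \<equiv> (\<lambda>z. L *v z) ^^ n"

text \<open>The substitution as a self-map of the full shift, so that its iterates are plain
  function powers.\<close>

definition T :: "(int^'d \<Rightarrow> 'a) \<Rightarrow> int^'d \<Rightarrow> 'a"
  where "T x = (\<lambda>k. \<zeta> (x (Q k)) (k - L *v Q k))"

lemma Tn_Suc: "(T ^^ Suc n) x k = \<zeta> ((T ^^ n) x (Q k)) (k - L *v Q k)"
  unfolding funpow.simps comp_apply by (subst T_def) (rule refl)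

lemma quot_rem:
  shows Q_add: "Q (L *v m + k) = m + Q k" and rem_in: "k - L *v Q k \<in> F1"
proof -
  obtain f j where f: "f \<in> F1" "k - f = L *v j"
    using domain unfolding fundamental_domain_def by blast
  then have k: "k = L *v j + f" by (simp add: algebra_simps)
  have Qk: "Q k = j"
    unfolding k by (rule lattice_quot_eq[OF expansion domain f(1)])
  show "k - L *v Q k \<in> F1" unfolding Qk using f(1) by (simp add: k)
  have "L *v m + k = L *v (m + j) + f" by (simp add: k matrix_vector_right_distrib)
  then show "Q (L *v m + k) = m + Q k"
    using lattice_quot_eq[OF expansion domain f(1), of "m + j"] by (simp add: Qk)
qed

lemma Q_0: "Q 0 = 0"
proof -
  have "0 \<in> F1" using domain by (simp add: fundamental_domain_def)
  from lattice_quot_eq[OF expansion domain this, of 0] show ?thesis by simp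
qed

lemma Qn_0: "(Q ^^ n) 0 = 0"
  by (induction n) (auto simp: Q_0)

lemma E_add: "E n (u + v) = E n u + E n v"
  by (induction n) (auto simp: matrix_vector_right_distrib)

lemma Qn_Suc: "(Q ^^ Suc n) k = (Q ^^ n) (Q k)"
  by (simp only: funpow_Suc_right comp_apply)

lemma Qn_add: "(Q ^^ n) (E n m + k) = m + (Q ^^ n) k"
proof (induction n arbitrary: k)
  case (Suc n)
  have "E (Suc n) m = L *v E n m" by simp
  then show ?case by (simp only: Qn_Suc Q_add Suc.IH)
qed simp

lemma Qn_E: "(Q ^^ n) (E n m) = m"
  using Qn_add[of n m 0] by (simp add: Qn_0)

text \<open>\<open>Q ^^ n\<close> is division by \<open>E n\<close> with remainders in
  \<open>F n\<close>: a point lies in \<open>F (Suc n)\<close> exactly when its quotient lies in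
  \<open>F n\<close>. Membership in supports thus becomes an equation.\<close>

lemma support_eq: "F n = {g. (Q ^^ n) g = 0}"
proof (induction n)
  case (Suc n)
  have "k \<in> F (Suc n) \<longleftrightarrow> Q k \<in> F n" for k
  proof
    assume "k \<in> F (Suc n)"
    then obtain j f where "j \<in> F n" "f \<in> F1" "k = L *v j + f" by auto
    then show "Q k \<in> F n" using lattice_quot_eq[OF expansion domain] by metis
  next
    assume "Q k \<in> F n"
    moreover have "k \<in> {L *v Q k + (k - L *v Q k)}" by simp
    ultimately show "k \<in> F (Suc n)" using rem_in[of k] unfolding support.simps by blast
  qed
  then show ?case using Suc by (simp add: Qn_Suc set_eq_iff del: funpow.simps(2) support.simps(2))
qed auto

lemma support_add: "k \<in> F (m + n) \<longleftrightarrow> (Q ^^ n) k \<in> F m"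
  by (simp add: support_eq funpow_add)

lemma rem_in_support: "k - E n ((Q ^^ n) k) \<in> F n"
proof -
  have "(Q ^^ n) k = (Q ^^ n) (E n ((Q ^^ n) k) + (k - E n ((Q ^^ n) k)))" by simp
  then have "(Q ^^ n) (k - E n ((Q ^^ n) k)) = 0" unfolding Qn_add by simp
  then show ?thesis by (simp add: support_eq)
qed

lemma support_quot: "g \<in> F n \<Longrightarrow> (Q ^^ n) (E n m + g) = m"
  by (simp add: Qn_add support_eq)

text \<open>The recursion starts from a constant function, so a pattern is itself a configuration
  and facts about \<open>T ^^ n\<close> apply to it.\<close>

lemma subst_iter_eq: "subst_iter L F1 \<zeta> n a = (T ^^ n) (\<lambda>_. a)"
  by (induction n) (auto simp: T_def)

section \<open>Equivariance, locality and block structure of the iterated substitution\<close>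

lemma Tn_shift: "(T ^^ n) (shift m x) = shift (E n m) ((T ^^ n) x)"
proof (induction n)
  case (Suc n)
  have "T (shift m x) = shift (L *v m) (T x)" for m x
    unfolding T_def shift_def by (rule ext) (simp add: Q_add matrix_vector_right_distrib)
  then show ?case using Suc by simp
qed auto

lemma Tn_local: "x ((Q ^^ n) k) = x' ((Q ^^ n) k) \<Longrightarrow> (T ^^ n) x k = (T ^^ n) x' k"
proof (induction n arbitrary: k)
  case (Suc n)
  then have "(T ^^ n) x (Q k) = (T ^^ n) x' (Q k)"
    by (intro Suc.IH) (simp add: Qn_Suc del: funpow.simps(2))
  then show ?case unfolding Tn_Suc by (rule arg_cong)
qed auto

lemma Tn_block:
  assumes "g \<in> F n"
  shows "(T ^^ n) x (E n j + g) = subst_iter L F1 \<zeta> n (x j) g"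
proof -
  have "(T ^^ n) x (E n j + g) = (T ^^ n) (shift j x) g"
    unfolding Tn_shift by (simp add: shift_def)
  also have "\<dots> = (T ^^ n) (\<lambda>_. x j) g"
    using assms by (intro Tn_local) (simp add: support_eq shift_def)
  finally show ?thesis by (simp add: subst_iter_eq)
qed

lemma Tn_cong:
  assumes "\<And>f j. f \<in> F n \<Longrightarrow> subst_iter L F1 \<zeta> n (x j) f = subst_iter L F1 \<zeta> n (x' j) f"
  shows "(T ^^ n) x = (T ^^ n) x'"
proof
  fix k
  have "k = E n ((Q ^^ n) k) + (k - E n ((Q ^^ n) k))" by simp
  moreover have "(T ^^ n) x (E n ((Q ^^ n) k) + (k - E n ((Q ^^ n) k))) =
      (T ^^ n) x' (E n ((Q ^^ n) k) + (k - E n ((Q ^^ n) k)))"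
    unfolding Tn_block[OF rem_in_support] by (rule assms[OF rem_in_support])
  ultimately show "(T ^^ n) x k = (T ^^ n) x' k" by simp
qed

text \<open>A finite pattern of \<open>(T ^^ n) x\<close> is produced by the finitely many letters
  of \<open>x\<close> on \<open>W\<close>, the quotients of its sites. These letters occur together
  in some \<open>N\<close>-th iterate, so the pattern occurs in the
  \<open>(N + n)\<close>-th.\<close>

lemma Tn_in_shift:
  assumes "x \<in> X"
  shows "(T ^^ n) x \<in> X"
  unfolding subst_shift_def
proof (intro CollectI allI impI)
  fix P p assume "finite P \<and> occurs_in P p UNIV ((T ^^ n) x)"
  then obtain m where P: "finite P" and m: "\<forall>k\<in>P. (T ^^ n) x (m + k) = p k"
    by (auto simp: occurs_in_def)
  define W where "W = (Q ^^ n) ` (+) m ` P"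
  have "finite W" "occurs_in W x UNIV x"
    using P by (auto simp: W_def occurs_in_def intro!: exI[of _ 0])
  then obtain N a where "N > 0" "occurs_in W x (F N) (subst_iter L F1 \<zeta> N a)"
    using assms unfolding subst_shift_def by blast
  then obtain c where N: "N > 0" "\<forall>j\<in>W. c + j \<in> F N \<and> subst_iter L F1 \<zeta> N a (c + j) = x j"
    unfolding occurs_in_def by blast
  have "E n c + m + k \<in> F (N + n) \<and> subst_iter L F1 \<zeta> (N + n) a (E n c + m + k) = p k"
    if k: "k \<in> P" for k
  proof
    have j: "(Q ^^ n) (m + k) \<in> W" using k by (auto simp: W_def)
    then show "E n c + m + k \<in> F (N + n)"
      using N(2) by (simp add: support_add add.assoc Qn_add)
    have "subst_iter L F1 \<zeta> (N + n) a (E n c + m + k) = (T ^^ n) (shift c ((T ^^ N) (\<lambda>_. a))) (m + k)"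
      unfolding Tn_shift by (simp add: subst_iter_eq shift_def add.assoc add.commute[of N] funpow_add)
    also have "\<dots> = (T ^^ n) x (m + k)"
      using N(2) j by (intro Tn_local) (simp add: shift_def subst_iter_eq)
    finally show "subst_iter L F1 \<zeta> (N + n) a (E n c + m + k) = p k" using m k by simp
  qed
  then have "occurs_in P p (F (N + n)) (subst_iter L F1 \<zeta> (N + n) a)"
    unfolding occurs_in_def add.assoc[symmetric] by blast
  then show "\<exists>n>0. \<exists>a. occurs_in P p (F n) (subst_iter L F1 \<zeta> n a)"
    using N(1) by (metis add_gr_0)
qed

lemma occurs_in_trans: "occurs_in P p R r \<Longrightarrow> occurs_in R r S s \<Longrightarrow> occurs_in P p S s"
  unfolding occurs_in_def
proof (elim exE)
  fix m n assume m: "\<forall>k\<in>P. m + k \<in> R \<and> r (m + k) = p k"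
    and n: "\<forall>k\<in>R. n + k \<in> S \<and> s (n + k) = r k"
  have "n + m + k \<in> S \<and> s (n + m + k) = p k" if "k \<in> P" for k
    using m n that unfolding add.assoc by simp
  then show "\<exists>n. \<forall>k\<in>P. n + k \<in> S \<and> s (n + k) = p k" by blast
qed

lemma occurs_in_iterate:
  assumes "g \<in> F m" and "subst_iter L F1 \<zeta> m b g = a"
  shows "occurs_in (F n) (subst_iter L F1 \<zeta> n a) (F (m + n)) (subst_iter L F1 \<zeta> (m + n) b)"
  unfolding occurs_in_def
proof (intro exI ballI conjI)
  fix k assume k: "k \<in> F n"
  show "E n g + k \<in> F (m + n)"
    using k assms(1) by (simp add: support_add support_quot)
  have "subst_iter L F1 \<zeta> (m + n) b (E n g + k) = (T ^^ n) ((T ^^ m) (\<lambda>_. b)) (E n g + k)"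
    by (simp add: subst_iter_eq add.commute[of m] funpow_add)
  also have "\<dots> = subst_iter L F1 \<zeta> n ((T ^^ m) (\<lambda>_. b) g) k"
    by (rule Tn_block[OF k])
  finally show "subst_iter L F1 \<zeta> (m + n) b (E n g + k) = subst_iter L F1 \<zeta> n a k"
    using assms(2) by (simp add: subst_iter_eq)
qed

subsection \<open>Contraction by the inverse matrix\<close>

abbreviation M where "M \<equiv> matrix_inv (real_mat L)"
abbreviation G where "G n \<equiv> (\<lambda>u. M *v u) ^^ n"
abbreviation l where "l \<equiv> inv_opnorm L"

text \<open>Expansion forces a trivial kernel, hence invertibility, so the choice in
  \<open>matrix_inv\<close> yields a two-sided inverse.\<close>

lemma inverse_matrix:
  shows inverse_left: "M *v (real_mat L *v u) = u" and inverse_right: "real_mat L *v (M *v u) = u"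
proof -
  obtain c where c: "c > 1" "\<And>x::real^'d. x \<noteq> 0 \<Longrightarrow> norm (real_mat L *v x) > c * norm x"
    using expansion unfolding expansion_matrix_def by blast
  have "x = 0" if "real_mat L *v x = 0" for x
  proof (rule ccontr)
    assume "x \<noteq> 0"
    then have "c * norm x < 0" using c(2)[of x] that by simp
    then show False using c(1) by (simp add: mult_less_0_iff)
  qed
  then have "invertible (real_mat L)"
    unfolding invertible_left_inverse matrix_left_invertible_ker by blast
  then have "\<exists>A'. real_mat L ** A' = mat 1 \<and> A' ** real_mat L = mat 1"
    by (simp add: invertible_def)
  then have "real_mat L ** M = mat 1 \<and> M ** real_mat L = mat 1"
    unfolding matrix_inv_def by (rule someI_ex)
  then show "M *v (real_mat L *v u) = u" "real_mat L *v (M *v u) = u"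
    by (simp_all add: matrix_vector_mul_assoc)
qed

lemma norm_inverse: "norm (M *v u) \<le> l * norm u"
  unfolding inv_opnorm_def by (rule onorm) (rule matrix_vector_mul_bounded_linear)

lemma inv_opnorm_bounds: shows inv_opnorm_nonneg: "0 \<le> l" and inv_opnorm_less_1: "l < 1"
proof -
  show "0 \<le> l"
    unfolding inv_opnorm_def by (rule onorm_pos_le) (rule matrix_vector_mul_bounded_linear)
  obtain c where c: "c > 1" "\<And>x::real^'d. x \<noteq> 0 \<Longrightarrow> norm (real_mat L *v x) > c * norm x"
    using expansion unfolding expansion_matrix_def by blast
  have "norm (M *v u) \<le> inverse c * norm u" for u
  proof (cases "M *v u = 0")
    case False
    then have "c * norm (M *v u) < norm u" using c(2)[OF False] by (simp add: inverse_right)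
    then show ?thesis using c(1) by (simp add: field_simps)
  qed (use c in simp)
  then have "l \<le> inverse c" unfolding inv_opnorm_def by (rule onorm_le)
  also have "inverse c < 1" using c(1) by (simp add: field_simps)
  finally show "l < 1" .
qed

text \<open>Every \<open>f\<close> in \<open>F1\<close> is the remainder of some \<open>k\<close>
  congruent to it in a fixed finite box, so \<open>F1\<close> lies in the image of that box.\<close>

lemma finite_F1: "finite F1"
proof -
  define R where "R = nat \<lceil>onorm (\<lambda>x. real_mat L *v x) * real CARD('d)\<rceil>"
  have "f \<in> (\<lambda>k. k - L *v Q k) ` {v. \<forall>i. \<bar>v $ i\<bar> \<le> int R}" if f: "f \<in> F1" for f
  proof
    \<comment> \<open>Rounding down leaves a fractional part with coordinates in [0, 1), and
      \<open>k\<close> is its image under \<open>L\<close>, hence bounded independently of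
      \<open>f\<close>.\<close>
    define z :: "int^'d" where "z = (\<chi> i. \<lfloor>(M *v real_vec f) $ i\<rfloor>)"
    define k where "k = L *v (- z) + f"
    have "Q k = - z" unfolding k_def by (rule lattice_quot_eq[OF expansion domain f])
    then show "f = k - L *v Q k" by (simp add: k_def)
    have "real_vec k = real_vec f - real_vec (L *v z)"
      by (simp add: k_def vec_eq_iff matrix_vector_mult_def sum_negf)
    also have "\<dots> = real_mat L *v (M *v real_vec f - real_vec z)"
      by (simp add: matrix_vector_mult_diff_distrib inverse_right real_vec_simps)
    also have "norm \<dots> \<le> onorm (\<lambda>x. real_mat L *v x) * norm (M *v real_vec f - real_vec z)"
      by (rule onorm) (rule matrix_vector_mul_bounded_linear)
    also have "\<dots> \<le> onorm (\<lambda>x. real_mat L *v x) * real CARD('d)"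
    proof (rule mult_left_mono)
      have "norm (M *v real_vec f - real_vec z) \<le> (\<Sum>i\<in>UNIV. \<bar>(M *v real_vec f - real_vec z) $ i\<bar>)"
        by (rule norm_le_l1_cart)
      also have "\<dots> \<le> (\<Sum>i\<in>(UNIV::'d set). 1)"
      proof (rule sum_mono)
        fix i
        show "\<bar>(M *v real_vec f - real_vec z) $ i\<bar> \<le> 1"
          using of_int_floor_le[of "(M *v real_vec f) $ i"]
            floor_correct[of "(M *v real_vec f) $ i"] by (simp add: z_def abs_le_iff) linarith
      qed
      finally show "norm (M *v real_vec f - real_vec z) \<le> real CARD('d)" by simp
      show "0 \<le> onorm (\<lambda>x. real_mat L *v x)"
        by (rule onorm_pos_le) (rule matrix_vector_mul_bounded_linear)
    qed
    finally have norm_k: "norm (real_vec k) \<le> onorm (\<lambda>x. real_mat L *v x) * real CARD('d)" .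
    have "\<bar>k $ i\<bar> \<le> int R" for i
    proof -
      have "\<bar>real_of_int (k $ i)\<bar> \<le> norm (real_vec k)"
        using component_le_norm_cart[of "real_vec k" i] by simp
      then have "\<bar>real_of_int (k $ i)\<bar> \<le> real_of_int \<lceil>onorm (\<lambda>x. real_mat L *v x) * real CARD('d)\<rceil>"
        using norm_k by linarith
      then show ?thesis unfolding R_def by linarith
    qed
    then show "k \<in> {v. \<forall>i. \<bar>v $ i\<bar> \<le> int R}" by simp
  qed
  then have "F1 \<subseteq> (\<lambda>k. k - L *v Q k) ` {v. \<forall>i. \<bar>v $ i\<bar> \<le> int R}" by blast
  then show ?thesis using card_int_box(1) finite_subset by blast
qed

lemma finite_support: "finite (F n)"
  by (induction n) (auto simp: finite_F1)

lemma norm_F1_le: "f \<in> F1 \<Longrightarrow> norm (real_vec f) \<le> set_norm F1"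
  unfolding set_norm_def using finite_F1 by (intro Max_ge) auto

lemma G_add: "G n (u + v) = G n u + G n v" and G_diff: "G n (u - v) = G n u - G n v"
  by (induction n) (auto simp: matrix_vector_right_distrib matrix_vector_mult_diff_distrib)

lemma norm_G: "norm (G n u) \<le> l ^ n * norm u"
proof (induction n)
  case (Suc n)
  have "norm (G (Suc n) u) \<le> l * norm (G n u)" using norm_inverse by simp
  also have "\<dots> \<le> l * (l ^ n * norm u)"
    using Suc inv_opnorm_nonneg by (rule mult_left_mono)
  finally show ?case by (simp add: mult.assoc)
qed simp

lemma G_Suc: "G (Suc n) u = G n (M *v u)"
  by (simp only: funpow_Suc_right comp_apply)

lemma G_E: "G n (real_vec (E n v)) = real_vec v"
proof (induction n)
  case (Suc n)
  have "E (Suc n) v = L *v E n v" by simp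
  then show ?case by (simp only: G_Suc real_vec_simps inverse_left Suc)
qed simp

text \<open>An element of \<open>F n\<close> is a sum of \<open>n\<close> digits scaled by powers of
  \<open>L\<close>; after \<open>G n\<close> the digits carry the factors \<open>l\<close>, ...,
  \<open>l ^ n\<close>, and the bound is this geometric sum.\<close>

lemma norm_G_support:
  "g \<in> F n \<Longrightarrow> norm (G n (real_vec g)) \<le> l * set_norm F1 / (1 - l) * (1 - l ^ n)"
proof (induction n arbitrary: g)
  case (Suc n)
  then obtain j h where jh: "j \<in> F n" "h \<in> F1" "g = L *v j + h" by auto
  let ?r = "l * set_norm F1 / (1 - l)"
  have "G (Suc n) (real_vec g) = G (Suc n) (real_mat L *v real_vec j) + G (Suc n) (real_vec h)"
    by (simp only: jh(3) real_vec_simps G_add)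
  also have "\<dots> = G n (real_vec j) + G (Suc n) (real_vec h)"
    by (simp only: G_Suc inverse_left)
  also have "norm \<dots> \<le> ?r * (1 - l ^ n) + l ^ Suc n * set_norm F1"
  proof (rule norm_triangle_mono)
    show "norm (G n (real_vec j)) \<le> ?r * (1 - l ^ n)" using Suc.IH jh(1) .
    have "norm (G (Suc n) (real_vec h)) \<le> l ^ Suc n * norm (real_vec h)" by (rule norm_G)
    also have "\<dots> \<le> l ^ Suc n * set_norm F1"
      using norm_F1_le[OF jh(2)] inv_opnorm_nonneg by (intro mult_left_mono) auto
    finally show "norm (G (Suc n) (real_vec h)) \<le> l ^ Suc n * set_norm F1" .
  qed
  also have "\<dots> = ?r * (1 - l ^ Suc n)"
    using inv_opnorm_less_1 by (simp add: field_simps)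
  finally show ?case .
qed (simp add: zero_vec_def[symmetric])

abbreviation R where "R \<equiv> nat \<lceil>3 * l * set_norm F1 / (1 - l)\<rceil> + 1"
abbreviation box where "box \<equiv> {v::int^'d. \<forall>i. \<bar>v $ i\<bar> \<le> int R}"

text \<open>
  Under \<open>L\<^sup>-\<^sup>n\<close> an element of \<open>F\<^sub>n\<close> gets norm at most \<open>\<parallel>L\<^sup>-\<^sup>1\<parallel> \<parallel>F\<^sub>1\<parallel> / (1 - \<parallel>L\<^sup>-\<^sup>1\<parallel>)\<close>; the three such
  elements below account for the factor 3 in \<open>R\<close>, and the summand 1 absorbs the window \<open>V\<close>.
\<close>

lemma window_contracts:
  assumes "finite V"
  shows "\<exists>n. \<forall>f\<in>F n. \<forall>q\<in>F n. \<forall>g\<in>F n. \<forall>b\<in>V. \<forall>v. E n v = f - q - g + b \<longrightarrow> v \<in> box"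
proof -
  obtain t where t: "\<And>b. b \<in> V \<Longrightarrow> norm (real_vec b) \<le> t"
    using assms by (meson Max_ge finite_imageI imageI)
  have "(\<lambda>n. l ^ n * t) \<longlonglongrightarrow> 0 * t"
    using inv_opnorm_bounds by (intro tendsto_mult LIMSEQ_power_zero tendsto_const) auto
  then have "\<forall>\<^sub>F n in sequentially. l ^ n * t < 1" by (intro order_tendstoD) auto
  then obtain n where n: "l ^ n * t < 1" unfolding eventually_sequentially by blast
  let ?r = "l * set_norm F1 / (1 - l)"
  have "0 \<le> set_norm F1"
    using norm_F1_le[of 0] domain by (auto simp: fundamental_domain_def intro: order_trans[OF norm_ge_zero])
  then have "0 \<le> ?r" using inv_opnorm_bounds by auto
  then have "?r * (1 - l ^ n) \<le> ?r"
    by (rule mult_left_le[rotated]) (simp add: inv_opnorm_nonneg)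
  then have F_le: "norm (G n (real_vec g)) \<le> ?r" if "g \<in> F n" for g
    using norm_G_support[OF that] by linarith
  have "v \<in> box" if "f \<in> F n" "q \<in> F n" "g \<in> F n" "b \<in> V" "E n v = f - q - g + b" for f q g b v
  proof -
    have "real_vec v = G n (real_vec (f - q - g + b))" using G_E[of n v] that(5) by simp
    also have "\<dots> = G n (real_vec f) - G n (real_vec q) - G n (real_vec g) + G n (real_vec b)"
      by (simp only: real_vec_simps G_add G_diff)
    also have "norm \<dots> \<le> ?r + ?r + ?r + l ^ n * t"
    proof -
      have "norm (G n (real_vec b)) \<le> l ^ n * norm (real_vec b)" by (rule norm_G)
      also have "\<dots> \<le> l ^ n * t"
        using t[OF that(4)] inv_opnorm_nonneg by (intro mult_left_mono) auto
      finally have b: "norm (G n (real_vec b)) \<le> l ^ n * t" .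
      show ?thesis
        by (intro norm_triangle_mono order_trans[OF norm_triangle_ineq4] add_mono F_le that b)
    qed
    also have "\<dots> \<le> 3 * l * set_norm F1 / (1 - l) + 1" using n by simp
    finally have norm_v: "norm (real_vec v) \<le> 3 * l * set_norm F1 / (1 - l) + 1" .
    have "\<bar>v $ i\<bar> \<le> int R" for i
    proof -
      have "\<bar>real_of_int (v $ i)\<bar> \<le> norm (real_vec v)"
        using component_le_norm_cart[of "real_vec v" i] by simp
      then show ?thesis using norm_v by linarith
    qed
    then show ?thesis by simp
  qed
  then show ?thesis by blast
qed

end

section \<open>Desubstitution and minimality\<close>

locale primitive_constant_shape = constant_shape L F1 \<zeta>
  for L :: "int^'d^'d" and F1 and \<zeta> :: "'a::finite \<Rightarrow> int^'d \<Rightarrow> 'a" +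
  assumes primitive: "primitive_subst L F1 \<zeta>"
begin

abbreviation pat where "pat \<equiv> subst_iter L F1 \<zeta>"

text \<open>Take \<open>m\<close> from primitivity: \<open>a\<close> occurs in the
  \<open>m\<close>-th iterate of every \<open>b\<close>, and \<open>n\<close> further iterations
  expand it to its \<open>n\<close>-block.\<close>

lemma occurs_in_higher:
  "\<exists>m>0. \<forall>n a b. occurs_in (F n) (pat n a) (F (m + n)) (pat (m + n) b)"
proof -
  obtain m where m: "m > 0" "\<And>a b. b \<in> pat m a ` F m"
    using primitive unfolding primitive_subst_def by blast
  have "occurs_in (F n) (pat n a) (F (m + n)) (pat (m + n) b)" for n a b
    using m(2)[of a b] occurs_in_iterate by blast
  then show ?thesis using m(1) by blast
qed

text \<open>Desubstituting \<open>n\<close> times needs an occurrence of level above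
  \<open>n\<close>; primitivity raises the level past any \<open>K\<close>.\<close>

lemma pattern_occurs:
  assumes "y \<in> X" "finite P"
  shows "\<exists>N>K. \<exists>a. occurs_in P y (F N) (pat N a)"
proof (induction K)
  case 0
  have "occurs_in P y UNIV y" unfolding occurs_in_def by (auto intro: exI[of _ 0])
  then show ?case using assms unfolding subst_shift_def by blast
next
  case (Suc K)
  then obtain N a where N: "N > K" "occurs_in P y (F N) (pat N a)" by blast
  obtain m where m: "m > 0" "occurs_in (F N) (pat N a) (F (m + N)) (pat (m + N) a)"
    using occurs_in_higher by blast
  then have "occurs_in P y (F (m + N)) (pat (m + N) a)" using N(2) occurs_in_trans by blast
  moreover have "m + N > Suc K" using m(1) N(1) by simp
  ultimately show ?case by blast
qed

lemma pat_add: "pat (m + n) a = (T ^^ n) (pat m a)"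
  by (simp add: subst_iter_eq add.commute[of m] funpow_add)

text \<open>A large piece of \<open>y\<close> occurs at some \<open>m\<close> in
  \<open>pat N a\<close>, which is \<open>T ^^ n\<close> applied to \<open>pat (N - n) a\<close>.
  Dividing \<open>m\<close> by \<open>E n\<close> gives the offset \<open>q\<close> as remainder
  and, by shifting along the quotient, the preimage \<open>z\<close>.\<close>

lemma desubstitute_window:
  assumes y: "y \<in> X" and W: "finite W"
  shows "\<exists>z. (\<exists>q\<in>F n. \<forall>k. (Q ^^ n) (q + k) \<in> W \<longrightarrow> y k = (T ^^ n) z (q + k)) \<and>
    (\<exists>N>0. \<exists>a. occurs_in W z (F N) (pat N a))"
proof -
  \<comment> \<open>The offset is known only once an occurrence is found, so \<open>P\<close>
    provides for every \<open>q\<close> in \<open>F n\<close>.\<close>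
  define P where "P = (\<Union>q\<in>F n. \<Union>j\<in>W. (\<lambda>g. E n j + g - q) ` F n)"
  have P: "k \<in> P" if "q \<in> F n" "(Q ^^ n) (q + k) \<in> W" for k q
  proof -
    have "k = E n ((Q ^^ n) (q + k)) + ((q + k) - E n ((Q ^^ n) (q + k))) - q" by simp
    then show ?thesis unfolding P_def using that rem_in_support[of "q + k" n] by blast
  qed
  have "finite P" unfolding P_def using W finite_support by blast
  then obtain N a where "N > n" "occurs_in P y (F N) (pat N a)"
    using pattern_occurs[OF y] by blast
  then obtain m where N: "N > n" and m: "\<forall>k\<in>P. m + k \<in> F N \<and> pat N a (m + k) = y k"
    unfolding occurs_in_def by blast
  define j where "j = (Q ^^ n) m"
  define q where "q = m - E n j"
  have q: "q \<in> F n" unfolding q_def j_def by (rule rem_in_support)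
  define z where "z = shift j (pat (N - n) a)"
  have Tz: "(T ^^ n) z = shift (E n j) (pat N a)"
    unfolding z_def Tn_shift pat_add[symmetric] using N by simp
  have "y k = (T ^^ n) z (q + k)" if k: "(Q ^^ n) (q + k) \<in> W" for k
    using m P[OF q k] unfolding Tz by (simp add: shift_def q_def)
  moreover have "j + i \<in> F (N - n) \<and> pat (N - n) a (j + i) = z i" if i: "i \<in> W" for i
  proof
    have Qi: "(Q ^^ n) (q + (E n i - q)) = i" by (simp add: Qn_E)
    then have "E n i - q \<in> P" using P[OF q] i by simp
    then have "m + (E n i - q) \<in> F (N - n + n)" using m N by simp
    then have "(Q ^^ n) (m + (E n i - q)) \<in> F (N - n)" unfolding support_add .
    moreover have "m + (E n i - q) = E n (j + i)" by (simp add: q_def E_add)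
    ultimately show "j + i \<in> F (N - n)" by (simp only: Qn_E)
  qed (simp add: z_def shift_def)
  ultimately have "(\<exists>q\<in>F n. \<forall>k. (Q ^^ n) (q + k) \<in> W \<longrightarrow> y k = (T ^^ n) z (q + k)) \<and>
    occurs_in W z (F (N - n)) (pat (N - n) a)"
    unfolding occurs_in_def using q by blast
  then show ?thesis using N zero_less_diff by blast
qed

text \<open>Compactness joins the windowed preimages into one \<open>z\<close>. The second conjunct
  of \<open>D\<close> puts \<open>z\<close> into \<open>X\<close>.\<close>

lemma desubstitute:
  assumes y: "y \<in> X"
  shows "\<exists>z\<in>X. \<exists>q\<in>F n. y = shift q ((T ^^ n) z)"
proof -
  define D where "D = (\<lambda>W z. (\<exists>q\<in>F n. \<forall>k. (Q ^^ n) (q + k) \<in> W \<longrightarrow> y k = (T ^^ n) z (q + k)) \<and>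
    (\<exists>N>0. \<exists>a. occurs_in W z (F N) (pat N a)))"
  have "\<exists>z. \<forall>W. finite W \<longrightarrow> D W z"
  proof (rule local_compactness)
    show "\<exists>z. D W z" if "finite W" for W
      unfolding D_def using desubstitute_window[OF y that] .
  next
    fix V W z assume VW: "V \<subseteq> W" and D: "D W z"
    have "occurs_in V z (F N) (pat N a)" if "occurs_in W z (F N) (pat N a)" for N a
      using that VW unfolding occurs_in_def by blast
    then show "D V z" using D VW unfolding D_def by blast
  next
    fix W z z' assume eq: "\<forall>i\<in>W. z i = z' i" and D: "D W z"
    have "(T ^^ n) z (q + k) = (T ^^ n) z' (q + k)" if "(Q ^^ n) (q + k) \<in> W" for q k
      using that eq by (intro Tn_local) blast
    moreover have "occurs_in W z' (F N) (pat N a)" if "occurs_in W z (F N) (pat N a)" for N a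
      using that eq unfolding occurs_in_def by simp
    ultimately show "D W z'" using D unfolding D_def by fastforce
  qed
  then obtain z where z: "\<And>W. finite W \<Longrightarrow> D W z" by blast
  have "\<exists>n>0. \<exists>a. occurs_in P p (F n) (pat n a)" if P: "finite P" "occurs_in P p UNIV z" for P p
  proof -
    obtain m where m: "\<forall>k\<in>P. z (m + k) = p k" using P(2) unfolding occurs_in_def by blast
    have "finite ((+) m ` P)" using P(1) by simp
    then obtain N a where "N > 0" "occurs_in ((+) m ` P) z (F N) (pat N a)"
      using z unfolding D_def by blast
    moreover have "occurs_in P p ((+) m ` P) z" using m unfolding occurs_in_def by blast
    ultimately show ?thesis using occurs_in_trans by blast
  qed
  then have "z \<in> X" unfolding subst_shift_def by blast
  \<comment> \<open>So far \<open>q\<close> depends on the window; finiteness of \<open>F n\<close>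
    yields one that serves all windows.\<close>
  have "\<exists>q\<in>F n. \<forall>W. finite W \<longrightarrow> (\<forall>k. (Q ^^ n) (q + k) \<in> W \<longrightarrow> y k = (T ^^ n) z (q + k))"
    by (rule finite_pigeonhole_windows[OF finite_support]) (use z D_def in blast)+
  then obtain q where "q \<in> F n"
    and q: "\<And>W k. finite W \<Longrightarrow> (Q ^^ n) (q + k) \<in> W \<Longrightarrow> y k = (T ^^ n) z (q + k)"
    by blast
  have "y = shift q ((T ^^ n) z)"
    unfolding shift_def using q[of "{(Q ^^ n) (q + k)}" k for k] by (intro ext) simp
  then show ?thesis using \<open>z \<in> X\<close> \<open>q \<in> F n\<close> by blast
qed

text \<open>A pattern of \<open>y\<close> lies in some \<open>pat N a\<close>, hence in the
  \<open>(m + N)\<close>-block of every letter, and by desubstitution \<open>x\<close> contains such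
  a block.\<close>

lemma subst_shift_minimal:
  assumes x: "x \<in> X" and y: "y \<in> X" and W: "finite W"
  shows "\<exists>m. \<forall>k\<in>W. x (m + k) = y k"
proof -
  obtain N a where N: "occurs_in W y (F N) (pat N a)"
    using pattern_occurs[OF y W] by blast
  obtain m where m: "\<And>n a b. occurs_in (F n) (pat n a) (F (m + n)) (pat (m + n) b)"
    using occurs_in_higher by blast
  obtain z q where z: "x = shift q ((T ^^ (m + N)) z)"
    using desubstitute[OF x] by blast
  \<comment> \<open>The instance of \<open>E_add\<close> forces \<open>E (m + N) 0 = 0\<close>,
    which places the block of \<open>z 0\<close> at \<open>- q\<close>.\<close>
  have "x (- q + g) = pat (m + N) (z 0) g" if "g \<in> F (m + N)" for g
    using Tn_block[OF that, of z 0] E_add[of "m + N" 0 0] unfolding z shift_def by simp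
  then have "occurs_in (F (m + N)) (pat (m + N) (z 0)) UNIV x"
    unfolding occurs_in_def by blast
  then have "occurs_in W y UNIV x" using N m occurs_in_trans by meson
  then show ?thesis unfolding occurs_in_def by blast
qed

section \<open>Determination of an automorphism by its value at one point\<close>

lemma automorphism_simps:
  assumes "\<phi> \<in> automorphisms X" "x \<in> X"
  shows automorphism_in: "\<phi> x \<in> X"
    and automorphism_apply: "\<phi> x k = \<phi> (shift k x) 0"
proof -
  show "\<phi> x \<in> X"
    using assms automorphisms_Bij Bij_imp_funcset by blast
  have "\<phi> (shift k x) = shift k (\<phi> x)"
    using assms unfolding automorphisms_def by simp
  then show "\<phi> x k = \<phi> (shift k x) 0" by (simp add: shift_def)
qed

text \<open>By minimality \<open>x\<close> looks somewhere like \<open>y\<close> near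
  \<open>k\<close>, on the windows of both maps, and there the equation is known.\<close>

lemma automorphism_eq_from_point:
  assumes \<phi>: "\<phi> \<in> automorphisms X" and \<psi>: "\<psi> \<in> automorphisms X"
    and x: "x \<in> X" and eq: "\<phi> x = shift q (\<psi> x)" and y: "y \<in> X"
  shows "\<phi> y = shift q (\<psi> y)"
proof
  fix k
  note sh = shift_in_subst_shift[of _ L F1 \<zeta>]
  obtain V where V: "finite V" "\<And>x x'. x \<in> X \<Longrightarrow> x' \<in> X \<Longrightarrow> \<forall>k\<in>V. x k = x' k \<Longrightarrow> \<phi> x 0 = \<phi> x' 0"
    using curtis_hedlund_lyndon_window[OF \<phi>] by blast
  obtain U where U: "finite U" "\<And>x x'. x \<in> X \<Longrightarrow> x' \<in> X \<Longrightarrow> \<forall>k\<in>U. x k = x' k \<Longrightarrow> \<psi> x 0 = \<psi> x' 0"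
    using curtis_hedlund_lyndon_window[OF \<psi>] by blast
  \<comment> \<open>The window of \<open>\<psi>\<close> is translated by \<open>q\<close>, since
    \<open>\<psi>\<close> is evaluated \<open>q\<close> further on.\<close>
  obtain m where m: "\<forall>i\<in>V \<union> (+) q ` U. x (m + i) = shift k y i"
    using subst_shift_minimal[OF x sh[OF y], of "V \<union> (+) q ` U"] V(1) U(1) by blast
  have "\<phi> y k = \<phi> (shift k y) 0" by (rule automorphism_apply[OF \<phi> y])
  also have "\<dots> = \<phi> (shift m x) 0"
    using m by (intro V(2) sh x y) (simp add: shift_def)
  also have "\<dots> = \<psi> x (q + m)"
    using automorphism_apply[OF \<phi> x, of m] eq by (simp add: shift_def)
  also have "\<dots> = \<psi> (shift (q + m) x) 0" by (rule automorphism_apply[OF \<psi> x])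
  also have "\<dots> = \<psi> (shift (q + k) y) 0"
  proof (intro U(2) sh x y ballI)
    fix i assume "i \<in> U"
    then have "x (m + (q + i)) = shift k y (q + i)" using m by blast
    then show "shift (q + m) x i = shift (q + k) y i" by (simp add: shift_def add_ac)
  qed
  also have "\<dots> = shift q (\<psi> y) k"
    using automorphism_apply[OF \<psi> y, of "q + k"] by (simp add: shift_def)
  finally show "\<phi> y k = shift q (\<psi> y) k" .
qed

subsection \<open>Counting automorphisms\<close>

text \<open>
  Letters with the same image under \<open>\<zeta>\<^sup>n\<close> are identified by choosing a representative, so that the
  rules below stay over the original alphabet although \<open>\<zeta>\<close> need not be injective on letters.
\<close>

definition canonical :: "nat \<Rightarrow> 'a \<Rightarrow> 'a"
  where "canonical n a = (SOME b. \<forall>f\<in>F n. pat n b f = pat n a f)"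

text \<open>The predicate under the choice depends on the letter only through its image, so equal
  images get the very same representative.\<close>

lemma canonical_eq_iff:
  "canonical n a = canonical n b \<longleftrightarrow> (\<forall>f\<in>F n. pat n a f = pat n b f)"
proof
  have can: "\<forall>f\<in>F n. pat n (canonical n c) f = pat n c f" for c
    unfolding canonical_def by (rule someI[of _ c]) simp
  assume "canonical n a = canonical n b"
  then show "\<forall>f\<in>F n. pat n a f = pat n b f" using can[of a] can[of b] by simp
qed (simp add: canonical_def)

text \<open>The block of \<open>z m\<close> is read off \<open>(T ^^ n) x\<close> at sites
  \<open>E n m + f - q + b\<close>. These lie in blocks of letters \<open>x (m + v)\<close> with
  \<open>v\<close> in the box, so \<open>canonical n (z m)\<close> is a function of the box pattern
  \<open>u m\<close>.\<close>

lemma automorphism_rule: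
  assumes \<phi>: "\<phi> \<in> automorphisms X" and x: "x \<in> X"
    and V: "\<And>x x'. x \<in> X \<Longrightarrow> x' \<in> X \<Longrightarrow> \<forall>k\<in>V. x k = x' k \<Longrightarrow> \<phi> x 0 = \<phi> x' 0"
    and n: "\<forall>f\<in>F n. \<forall>q\<in>F n. \<forall>g\<in>F n. \<forall>b\<in>V. \<forall>v. E n v = f - q - g + b \<longrightarrow> v \<in> box"
    and q: "q \<in> F n" and eq: "\<phi> ((T ^^ n) x) = shift q ((T ^^ n) z)"
  shows "\<exists>r\<in>(box \<rightarrow>\<^sub>E UNIV) \<rightarrow>\<^sub>E UNIV.
    \<forall>m. r (restrict (\<lambda>v. canonical n (x (m + v))) box) = canonical n (z m)"
proof -
  define u where "u = (\<lambda>m. restrict (\<lambda>v. canonical n (x (m + v))) box)"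
  have x0: "(T ^^ n) x \<in> X" by (rule Tn_in_shift[OF x])
  have z: "pat n (z m) f = \<phi> (shift (E n m + f - q) ((T ^^ n) x)) 0" if "f \<in> F n" for m f
  proof -
    have "pat n (z m) f = shift q ((T ^^ n) z) (E n m + f - q)"
      using Tn_block[OF that, of z m] by (simp add: shift_def)
    then show ?thesis unfolding eq[symmetric] by (simp only: automorphism_apply[OF \<phi> x0])
  qed
  have "canonical n (z m) = canonical n (z m')" if "u m = u m'" for m m'
    unfolding canonical_eq_iff
  proof
    fix f assume f: "f \<in> F n"
    show "pat n (z m) f = pat n (z m') f"
      unfolding z[OF f]
    proof (intro V shift_in_subst_shift x0 ballI)
      fix b assume b: "b \<in> V"
      \<comment> \<open>Division of \<open>f - q + b\<close> by \<open>E n\<close>: \<open>v\<close>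
        selects the block and \<open>g\<close> the position in it, both independent of
        \<open>m\<close>.\<close>
      define v where "v = (Q ^^ n) (f - q + b)"
      define g where "g = f - q + b - E n v"
      have g: "g \<in> F n" unfolding g_def v_def by (rule rem_in_support)
      have "E n v = f - q - g + b" by (simp add: g_def)
      then have "v \<in> box" using n f q g b by blast
      then have "canonical n (x (m + v)) = canonical n (x (m' + v))"
        using fun_cong[OF that, of v] by (simp add: u_def)
      then have "pat n (x (m + v)) g = pat n (x (m' + v)) g"
        using g unfolding canonical_eq_iff by blast
      moreover have "shift (E n i + f - q) ((T ^^ n) x) b = pat n (x (i + v)) g" for i
      proof -
        have "E n i + f - q + b = E n (i + v) + g" by (simp add: g_def E_add)
        then show ?thesis unfolding shift_def by (simp only: Tn_block[OF g])
      qed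
      ultimately show "shift (E n m + f - q) ((T ^^ n) x) b = shift (E n m' + f - q) ((T ^^ n) x) b"
        by simp
    qed
  qed
  then have inv: "canonical n (z (inv_into UNIV u (u m))) = canonical n (z m)" for m
    using f_inv_into_f[OF rangeI[of u m]] by blast
  \<comment> \<open>Any site with pattern \<open>w\<close> gives the same value; on patterns that
    never appear in \<open>x\<close> the value is arbitrary.\<close>
  define r where "r = (\<lambda>w\<in>(box \<rightarrow>\<^sub>E UNIV). canonical n (z (inv_into UNIV u w)))"
  have "u m \<in> box \<rightarrow>\<^sub>E UNIV" for m by (simp add: u_def)
  then have "r (u m) = canonical n (z m)" for m unfolding r_def by (simp add: inv)
  moreover have "r \<in> (box \<rightarrow>\<^sub>E UNIV) \<rightarrow>\<^sub>E UNIV" unfolding r_def by simp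
  ultimately show ?thesis unfolding u_def by blast
qed

lemma card_rules:
  "finite ((box \<rightarrow>\<^sub>E (UNIV::'a set)) \<rightarrow>\<^sub>E (UNIV::'a set))"
  "card ((box \<rightarrow>\<^sub>E (UNIV::'a set)) \<rightarrow>\<^sub>E (UNIV::'a set)) =
    aut_bound CARD('d) CARD('a) l (set_norm F1)"
proof -
  have fin: "finite (box \<rightarrow>\<^sub>E (UNIV::'a set))"
    by (intro finite_PiE card_int_box) simp
  show "finite ((box \<rightarrow>\<^sub>E (UNIV::'a set)) \<rightarrow>\<^sub>E (UNIV::'a set))"
    by (intro finite_PiE fin) simp
  show "card ((box \<rightarrow>\<^sub>E (UNIV::'a set)) \<rightarrow>\<^sub>E (UNIV::'a set)) =
      aut_bound CARD('d) CARD('a) l (set_norm F1)"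
    unfolding card_funcsetE[OF fin] card_funcsetE[OF card_int_box(1)] card_int_box(2)
      aut_bound_def Let_def ..
qed

text \<open>At a fixed \<open>x\<close> and a level \<open>n\<close> common to the finite family,
  each automorphism receives a rule, and equal rules force equality up to a shift, hence equality by
  \<open>ineq\<close>.\<close>

lemma card_inequivalent_automorphisms:
  assumes fin: "finite \<Phi>" and \<Phi>: "\<Phi> \<subseteq> automorphisms X"
    and ineq: "\<And>\<phi> \<psi> q. \<phi> \<in> \<Phi> \<Longrightarrow> \<psi> \<in> \<Phi> \<Longrightarrow> \<forall>y\<in>X. \<phi> y = shift q (\<psi> y) \<Longrightarrow> \<phi> = \<psi>"
  shows "card \<Phi> \<le> aut_bound CARD('d) CARD('a) l (set_norm F1)"
proof (cases "X = {}")
  \<comment> \<open>Over an empty \<open>X\<close> the premise of \<open>ineq\<close> is vacuous, so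
    there is at most one automorphism, and the bound is at least 1.\<close>
  case True
  then have "\<forall>\<phi>\<in>\<Phi>. \<forall>\<psi>\<in>\<Phi>. \<phi> = \<psi>" using ineq by simp
  then have "card \<Phi> \<le> 1" using card_le_Suc0_iff_eq[OF fin] by simp
  moreover have "aut_bound CARD('d) CARD('a) l (set_norm F1) \<ge> 1"
    unfolding aut_bound_def Let_def by (intro one_le_power) (simp add: Suc_leI)
  ultimately show ?thesis by linarith
next
  case False
  then obtain x where x: "x \<in> X" by blast
  have "\<forall>\<phi>\<in>\<Phi>. \<exists>V. finite V \<and> (\<forall>x\<in>X. \<forall>x'\<in>X. (\<forall>k\<in>V. x k = x' k) \<longrightarrow> \<phi> x 0 = \<phi> x' 0)"
    using curtis_hedlund_lyndon_window \<Phi> by blast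
  then obtain V where V: "\<forall>\<phi>\<in>\<Phi>. finite (V \<phi>) \<and>
      (\<forall>x\<in>X. \<forall>x'\<in>X. (\<forall>k\<in>V \<phi>. x k = x' k) \<longrightarrow> \<phi> x 0 = \<phi> x' 0)"
    by (rule bchoice[THEN exE])
  then have "finite (\<Union>\<phi>\<in>\<Phi>. V \<phi>)" using fin by blast
  then obtain n where n: "\<forall>f\<in>F n. \<forall>q\<in>F n. \<forall>g\<in>F n. \<forall>b\<in>(\<Union>\<phi>\<in>\<Phi>. V \<phi>).
      \<forall>v. E n v = f - q - g + b \<longrightarrow> v \<in> box"
    using window_contracts by blast
  let ?rule = "\<lambda>\<phi> z r. r \<in> (box \<rightarrow>\<^sub>E UNIV) \<rightarrow>\<^sub>E UNIV \<and>
    (\<exists>q. \<phi> ((T ^^ n) x) = shift q ((T ^^ n) z)) \<and>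
    (\<forall>m. r (restrict (\<lambda>v. canonical n (x (m + v))) box) = canonical n (z m))"
  have "\<exists>r z. ?rule \<phi> z r" if \<phi>: "\<phi> \<in> \<Phi>" for \<phi>
  proof -
    have aut: "\<phi> \<in> automorphisms X" using \<phi> \<Phi> by blast
    obtain z q where zq: "q \<in> F n" "\<phi> ((T ^^ n) x) = shift q ((T ^^ n) z)"
      using desubstitute[OF automorphism_in[OF aut Tn_in_shift[OF x]]] by blast
    have "\<exists>r\<in>(box \<rightarrow>\<^sub>E UNIV) \<rightarrow>\<^sub>E UNIV.
        \<forall>m. r (restrict (\<lambda>v. canonical n (x (m + v))) box) = canonical n (z m)"
    proof (rule automorphism_rule[OF aut x _ _ zq])
      show "\<phi> x 0 = \<phi> x' 0" if "x \<in> X" "x' \<in> X" "\<forall>k\<in>V \<phi>. x k = x' k" for x x'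
        using V \<phi> that by blast
      show "\<forall>f\<in>F n. \<forall>q\<in>F n. \<forall>g\<in>F n. \<forall>b\<in>V \<phi>. \<forall>v. E n v = f - q - g + b \<longrightarrow> v \<in> box"
        using n \<phi> by blast
    qed
    then show ?thesis using zq(2) by blast
  qed
  then have "\<forall>\<phi>\<in>\<Phi>. \<exists>r. \<exists>z. ?rule \<phi> z r" by blast
  then obtain r where r: "\<forall>\<phi>\<in>\<Phi>. \<exists>z. ?rule \<phi> z (r \<phi>)" by (rule bchoice[THEN exE])
  have "inj_on r \<Phi>"
  proof (rule inj_onI)
    fix \<phi> \<psi> assume \<phi>: "\<phi> \<in> \<Phi>" and \<psi>: "\<psi> \<in> \<Phi>" and eq: "r \<phi> = r \<psi>"
    obtain z q where z: "\<phi> ((T ^^ n) x) = shift q ((T ^^ n) z)"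
      "\<And>m. r \<phi> (restrict (\<lambda>v. canonical n (x (m + v))) box) = canonical n (z m)"
      using bspec[OF r \<phi>] by (elim exE conjE) (rule that, assumption, erule spec)
    obtain z' q' where z': "\<psi> ((T ^^ n) x) = shift q' ((T ^^ n) z')"
      "\<And>m. r \<psi> (restrict (\<lambda>v. canonical n (x (m + v))) box) = canonical n (z' m)"
      using bspec[OF r \<psi>] by (elim exE conjE) (rule that, assumption, erule spec)
    have "canonical n (z m) = canonical n (z' m)" for m
      unfolding z(2)[symmetric] z'(2)[symmetric] eq ..
    \<comment> \<open>The points \<open>z\<close> and \<open>z'\<close> may differ, but
      corresponding letters have equal \<open>n\<close>-blocks.\<close>
    then have "(T ^^ n) z = (T ^^ n) z'"
      unfolding canonical_eq_iff by (intro Tn_cong) blast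
    then have "\<phi> ((T ^^ n) x) = shift (q - q') (\<psi> ((T ^^ n) x))"
      unfolding z(1) z'(1) by (simp add: shift_shift)
    then have "\<forall>y\<in>X. \<phi> y = shift (q - q') (\<psi> y)"
      using automorphism_eq_from_point[OF _ _ Tn_in_shift[OF x]] \<phi> \<psi> \<Phi> by blast
    then show "\<phi> = \<psi>" using ineq \<phi> \<psi> by blast
  qed
  moreover have "r ` \<Phi> \<subseteq> (box \<rightarrow>\<^sub>E UNIV) \<rightarrow>\<^sub>E UNIV"
  proof (rule image_subsetI)
    fix \<phi> assume "\<phi> \<in> \<Phi>"
    with r show "r \<phi> \<in> (box \<rightarrow>\<^sub>E UNIV) \<rightarrow>\<^sub>E UNIV" by (elim ballE exE conjE) auto
  qed
  ultimately have "card \<Phi> \<le> card ((box \<rightarrow>\<^sub>E (UNIV::'a set)) \<rightarrow>\<^sub>E (UNIV::'a set))"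
    using card_rules(1) by (rule card_inj_on_le)
  then show ?thesis unfolding card_rules(2) .
qed

end

section \<open>Passage to the quotient group\<close>

theorem proposition6p5:
  fixes L :: "int^'d^'d" and F1 :: "(int^'d) set" and \<zeta> :: "'a::finite \<Rightarrow> int^'d \<Rightarrow> 'a"
  assumes "expansion_matrix L"
    and "fundamental_domain L F1"
    and "folner (support L F1)"
    and "primitive_subst L F1 \<zeta>"
    and "aperiodic_subst L F1 \<zeta>"
  shows "finite (carrier (Aut (subst_shift L F1 \<zeta>) Mod shifts (subst_shift L F1 \<zeta>))) \<and>
    card (carrier (Aut (subst_shift L F1 \<zeta>) Mod shifts (subst_shift L F1 \<zeta>)))
      \<le> aut_bound CARD('d) CARD('a) (inv_opnorm L) (set_norm F1)"
\<comment> \<open>A uniform bound on the finite subsets gives finiteness and the cardinality bound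
  together, so only finitely many cosets are treated at a time.\<close>
proof (rule finite_if_finite_subsets_card_bdd)
  interpret primitive_constant_shape L F1 \<zeta>
    by unfold_locales (fact assms)+
  interpret A: group "Aut X" by (rule group_Aut) (rule shift_in_subst_shift)
  have subgrp: "subgroup (shifts X) (Aut X)"
    using normal_shifts[OF shift_in_subst_shift] by (rule normal_imp_subgroup)
  have car: "carrier (Aut X) = automorphisms X" by (simp add: Aut_def)
  fix S assume "S \<subseteq> carrier (Aut X Mod shifts X)" and "finite S"
  \<comment> \<open>One representative for each coset in \<open>S\<close>.\<close>
  then obtain \<Phi> where \<Phi>: "\<Phi> \<subseteq> automorphisms X" "inj_on (\<lambda>\<phi>. shifts X #>\<^bsub>Aut X\<^esub> \<phi>) \<Phi>"
    and S: "S = (\<lambda>\<phi>. shifts X #>\<^bsub>Aut X\<^esub> \<phi>) ` \<Phi>"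
    unfolding carrier_FactGroup car subset_image_inj by blast
  have "card \<Phi> \<le> aut_bound CARD('d) CARD('a) (inv_opnorm L) (set_norm F1)"
  proof (rule card_inequivalent_automorphisms[OF _ \<Phi>(1)])
    show "finite \<Phi>" using \<open>finite S\<close> \<Phi>(2) unfolding S by (rule finite_imageD)
    fix \<phi> \<psi> q assume mem: "\<phi> \<in> \<Phi>" "\<psi> \<in> \<Phi>" and eq: "\<forall>y\<in>X. \<phi> y = shift q (\<psi> y)"
    have aut: "\<phi> \<in> automorphisms X" "\<psi> \<in> automorphisms X" using mem \<Phi>(1) by blast+
    \<comment> \<open>Equality up to a shift places \<open>\<phi>\<close> in the coset of
      \<open>\<psi>\<close>; injectivity on representatives then gives
      \<open>\<phi> = \<psi>\<close>.\<close>
    have sh: "restrict (shift q) X \<in> shifts X" by (simp add: shifts_def)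
    then have "restrict (shift q) X \<in> Bij X"
      using subgroup.subset[OF subgrp] automorphisms_Bij car by blast
    moreover have "\<psi> \<in> Bij X" using aut(2) automorphisms_Bij by blast
    ultimately have "restrict (shift q) X \<otimes>\<^bsub>Aut X\<^esub> \<psi> = compose X (restrict (shift q) X) \<psi>"
      by (simp add: Aut_def BijGroup_def)
    also have "\<dots> = \<phi>"
    proof (rule extensionalityI)
      show "\<phi> \<in> extensional X" using aut(1) by (simp add: automorphisms_def)
      show "compose X (restrict (shift q) X) \<psi> y = \<phi> y" if "y \<in> X" for y
        using eq that automorphism_in[OF aut(2) that] by (simp add: compose_def)
    qed (rule compose_extensional)
    finally have "\<phi> \<in> shifts X #>\<^bsub>Aut X\<^esub> \<psi>" using sh unfolding r_coset_def by blast
    then have "shifts X #>\<^bsub>Aut X\<^esub> \<psi> = shifts X #>\<^bsub>Aut X\<^esub> \<phi>"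
      using aut(2) subgrp by (intro A.repr_independence) (simp_all add: car)
    then show "\<phi> = \<psi>" using \<Phi>(2) mem by (auto dest: inj_onD)
  qed
  then show "card S \<le> aut_bound CARD('d) CARD('a) (inv_opnorm L) (set_norm F1)"
    unfolding S using card_image[OF \<Phi>(2)] by simp
qed

end
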